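(* Let $X$ be a metrizable space. Then $\mathrm{BMet}(X)$ is completely metrizable if and only if $X$ is $\sigma$-compact.
   Context: For a metrizable space $X$, $\mathrm{BMet}(X)$ is the set of all bounded metrics on $X$ that induce the topology of $X$, equipped with the topology induced by the supremum metric $\mathcal{D}_X(d,e)=\sup_{(x,y)\in X^2}|d(x,y)-e(x,y)|$. A topological space is completely metrizable if its topology is induced by some complete metric. A space is $\sigma$-compact if it is a countable union of compact subsets. *)

theory Defs
  imports "HOL-Analysis.Analysis"
begin

text \<open>
  A metric on \<^term>\<open>topspace X\<close> is a function on the whole type. Functions that differ only outside
  \<^term>\<open>topspace X\<close> represent the same metric, so the last condition chooses the representative
  that vanishes there; the value 0 is compatible with the global nonnegativity and symmetry
  required by \<^locale>\<open>Metric_space\<close>.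
\<close>

definition BMet :: "'a topology \<Rightarrow> ('a \<Rightarrow> 'a \<Rightarrow> real) set" where
  "BMet X = {d. Metric_space (topspace X) d \<and>
                Metric_space.mtopology (topspace X) d = X \<and>
                Metric_space.mbounded (topspace X) d (topspace X) \<and>
                (\<forall>x y. x \<notin> topspace X \<or> y \<notin> topspace X \<longrightarrow> d x y = 0)}"

text \<open>
  The supremum is only used for arguments in \<^term>\<open>BMet X\<close>, where it is finite, and the
  supremum over an empty index set (empty \<^term>\<open>X\<close>) is read as 0. The value 0 outside
  \<^term>\<open>BMet X\<close> only serves the global conditions of \<^locale>\<open>Metric_space\<close>.
\<close>

definition sup_metric :: "'a topology \<Rightarrow> ('a \<Rightarrow> 'a \<Rightarrow> real) \<Rightarrow> ('a \<Rightarrow> 'a \<Rightarrow> real) \<Rightarrow> real" where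
  "sup_metric X d e =
     (if d \<in> BMet X \<and> e \<in> BMet X \<and> topspace X \<noteq> {}
      then (SUP (x, y) \<in> topspace X \<times> topspace X. \<bar>d x y - e x y\<bar>)
      else 0)"

definition BMet_topology :: "'a topology \<Rightarrow> ('a \<Rightarrow> 'a \<Rightarrow> real) topology" where
  "BMet_topology X = Metric_space.mtopology (BMet X) (sup_metric X)"

definition sigma_compact_space :: "'a topology \<Rightarrow> bool" where
  "sigma_compact_space X \<longleftrightarrow>
     (\<exists>\<K>. countable \<K> \<and> (\<forall>K\<in>\<K>. compactin X K) \<and> \<Union>\<K> = topspace X)"

lemma BMet_bounded:
  assumes "d \<in> BMet X"
  obtains B where "\<And>x y. \<lbrakk>x \<in> topspace X; y \<in> topspace X\<rbrakk> \<Longrightarrow> \<bar>d x y\<bar> \<le> B"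
proof -
  interpret Metric_space "topspace X" d
    using assms by (simp add: BMet_def)
  have "mbounded (topspace X)"
    using assms by (simp add: BMet_def)
  then obtain B where "\<forall>x\<in>topspace X. \<forall>y\<in>topspace X. d x y \<le> B"
    unfolding mbounded_alt by auto
  then show ?thesis
    using that[of B] by simp
qed

lemma sup_metric_bdd_above:
  assumes "d \<in> BMet X" "e \<in> BMet X"
  shows "bdd_above ((\<lambda>(x, y). \<bar>d x y - e x y\<bar>) ` (topspace X \<times> topspace X))"
proof -
  obtain B where B: "\<And>x y. \<lbrakk>x \<in> topspace X; y \<in> topspace X\<rbrakk> \<Longrightarrow> \<bar>d x y\<bar> \<le> B"
    using BMet_bounded[OF assms(1)] by blast
  obtain C where C: "\<And>x y. \<lbrakk>x \<in> topspace X; y \<in> topspace X\<rbrakk> \<Longrightarrow> \<bar>e x y\<bar> \<le> C"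
    using BMet_bounded[OF assms(2)] by blast
  have "\<bar>d x y - e x y\<bar> \<le> B + C" if "x \<in> topspace X" "y \<in> topspace X" for x y
    using B[OF that] C[OF that] by linarith
  then show ?thesis
    by (intro bdd_aboveI[where M = "B + C"]) auto
qed

lemma sup_metric_upper:
  assumes "d \<in> BMet X" "e \<in> BMet X" "x \<in> topspace X" "y \<in> topspace X"
  shows "\<bar>d x y - e x y\<bar> \<le> sup_metric X d e"
proof -
  have "(case (x, y) of (x, y) \<Rightarrow> \<bar>d x y - e x y\<bar>)
          \<le> (SUP (x, y) \<in> topspace X \<times> topspace X. \<bar>d x y - e x y\<bar>)"
    using assms by (intro cSUP_upper sup_metric_bdd_above) auto
  then show ?thesis
    using assms by (auto simp: sup_metric_def)
qed

lemma sup_metric_least: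
  assumes "topspace X \<noteq> {}" "d \<in> BMet X" "e \<in> BMet X"
    and "\<And>x y. \<lbrakk>x \<in> topspace X; y \<in> topspace X\<rbrakk> \<Longrightarrow> \<bar>d x y - e x y\<bar> \<le> c"
  shows "sup_metric X d e \<le> c"
proof -
  have "(SUP (x, y) \<in> topspace X \<times> topspace X. \<bar>d x y - e x y\<bar>) \<le> c"
    using assms by (intro cSUP_least) auto
  then show ?thesis
    using assms by (simp add: sup_metric_def)
qed

lemma Metric_space_sup_metric: "Metric_space (BMet X) (sup_metric X)"
proof
  fix d e :: "'a \<Rightarrow> 'a \<Rightarrow> real"
  show "0 \<le> sup_metric X d e"
  proof (cases "d \<in> BMet X \<and> e \<in> BMet X \<and> topspace X \<noteq> {}")
    case True
    then obtain x where "x \<in> topspace X"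
      by blast
    then show ?thesis
      using True sup_metric_upper[of d X e x x] by force
  qed (auto simp: sup_metric_def)
  show "sup_metric X d e = sup_metric X e d"
    by (simp add: sup_metric_def abs_minus_commute conj_commute conj_left_commute)
next
  fix d e
  assume de: "d \<in> BMet X" "e \<in> BMet X"
  show "sup_metric X d e = 0 \<longleftrightarrow> d = e"
  proof
    assume 0: "sup_metric X d e = 0"
    have "d x y = e x y" for x y
    proof (cases "x \<in> topspace X \<and> y \<in> topspace X")
      case True
      then show ?thesis
        using sup_metric_upper[OF de, of x y] 0 by simp
    next
      case False
      then show ?thesis
        using de by (auto simp: BMet_def)
    qed
    then show "d = e"
      by blast
  next
    assume "d = e"
    then show "sup_metric X d e = 0"
      by (auto simp: sup_metric_def case_prod_beta)
  qed
next
  fix d e f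
  assume def: "d \<in> BMet X" "e \<in> BMet X" "f \<in> BMet X"
  show "sup_metric X d f \<le> sup_metric X d e + sup_metric X e f"
  proof (cases "topspace X = {}")
    case True
    then show ?thesis
      by (simp add: sup_metric_def)
  next
    case False
    then show ?thesis
    proof (rule sup_metric_least[OF _ def(1,3)])
      fix x y
      assume xy: "x \<in> topspace X" "y \<in> topspace X"
      show "\<bar>d x y - f x y\<bar> \<le> sup_metric X d e + sup_metric X e f"
        using sup_metric_upper[OF def(1,2) xy] sup_metric_upper[OF def(2,3) xy] by linarith
    qed
  qed
qed

end

theory Submission
  imports Defs
begin

text \<open>
  By the theorems of Alexandrov and Mazurkiewicz, \<open>BMet X\<close> is completely metrizable iff it is a
  G-delta set in the complete space of bounded functions on \<open>X \<times> X\<close>. If \<open>X\<close> is the union of compact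
  sets \<open>K\<^sub>n\<close> and \<open>d\<close> is a metric of \<open>X\<close>, then inside the closure of \<open>BMet X\<close> the members of \<open>BMet X\<close>
  are those \<open>e\<close> that for all \<open>n\<close>, \<open>m\<close> are bounded below by some \<open>c > 0\<close> on the pairs \<open>x \<in> K\<^sub>n\<close>, \<open>y \<in> X\<close>
  with \<open>d x y \<ge> 1 / m\<close>; these are countably many open conditions.

  Conversely, for a bounded 1-Lipschitz \<open>f \<ge> 0\<close> consider \<open>min (d x y) (f x + f y)\<close>. It belongs to
  \<open>BMet X\<close> if \<open>f\<close> is positive, and does not if \<open>f\<close> has a zero and lies below a positive 1-Lipschitz
  function with infimum 0. So if \<open>BMet X\<close> is a G-delta set and such functions \<open>f\<^sub>z\<close> depend continuously
  on a parameter \<open>z\<close>, then the parameters for which \<open>f\<^sub>z\<close> has a zero form an F-sigma set. If \<open>X\<close> is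
  separable, taking distances to the points \<open>z\<close> of a metrizable compactification shows that \<open>X\<close> is
  F-sigma in it. If \<open>X\<close> is not separable, then it has an uncountable separated subset, and the same
  argument shows that every copy in the real line of a part of it, less a sequence, is F-sigma. This
  is absurd: if the cardinality is at least that of the continuum, then the irrational numbers are
  such a copy, and otherwise no copy contains an uncountable closed set of reals.
\<close>

subsection \<open>Metric spaces inducing a given topology\<close>

lemma mtopology_eqI:
  assumes "Metric_space M d" "Metric_space M e"
    and de: "\<And>x r. \<lbrakk>x \<in> M; r > 0\<rbrakk> \<Longrightarrow> \<exists>s>0. \<forall>y\<in>M. d x y < s \<longrightarrow> e x y < r"
    and ed: "\<And>x r. \<lbrakk>x \<in> M; r > 0\<rbrakk> \<Longrightarrow> \<exists>s>0. \<forall>y\<in>M. e x y < s \<longrightarrow> d x y < r"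
  shows "Metric_space.mtopology M d = Metric_space.mtopology M e"
proof -
  interpret D: Metric_space M d by fact
  interpret E: Metric_space M e by fact
  show ?thesis
    unfolding topology_eq D.openin_mtopology E.openin_mtopology D.mball_def E.mball_def
  proof (intro allI conj_cong refl iffI; clarify)
    fix U x
    assume "U \<subseteq> M" "\<forall>x. x \<in> U \<longrightarrow> (\<exists>r>0. {y. x \<in> M \<and> y \<in> M \<and> d x y < r} \<subseteq> U)" "x \<in> U"
    then obtain r where "r > 0" "{y. x \<in> M \<and> y \<in> M \<and> d x y < r} \<subseteq> U" "x \<in> M"
      by blast
    then show "\<exists>r>0. {y. x \<in> M \<and> y \<in> M \<and> e x y < r} \<subseteq> U"
      using ed[of x r] by blast
  next
    fix U x
    assume "U \<subseteq> M" "\<forall>x. x \<in> U \<longrightarrow> (\<exists>r>0. {y. x \<in> M \<and> y \<in> M \<and> e x y < r} \<subseteq> U)" "x \<in> U"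
    then obtain r where "r > 0" "{y. x \<in> M \<and> y \<in> M \<and> e x y < r} \<subseteq> U" "x \<in> M"
      by blast
    then show "\<exists>r>0. {y. x \<in> M \<and> y \<in> M \<and> d x y < r} \<subseteq> U"
      using de[of x r] by blast
  qed
qed

lemma mtopology_eqD:
  assumes "Metric_space M d" "Metric_space M e"
    and eq: "Metric_space.mtopology M d = Metric_space.mtopology M e"
    and "x \<in> M" "r > 0"
  obtains s where "s > 0" "\<And>y. \<lbrakk>y \<in> M; d x y < s\<rbrakk> \<Longrightarrow> e x y < r"
proof -
  interpret D: Metric_space M d by fact
  interpret E: Metric_space M e by fact
  have "openin D.mtopology (E.mball x r)" "x \<in> E.mball x r"
    using assms by (simp_all add: eq)
  then obtain s where "s > 0" "D.mball x s \<subseteq> E.mball x r"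
    unfolding D.openin_mtopology by blast
  then show thesis
    using that[of s] \<open>x \<in> M\<close> by (auto simp: D.mball_def E.mball_def subset_iff)
qed

subsection \<open>Metrics as bounded functions\<close>

definition bfun :: "'a set \<Rightarrow> ('a \<times> 'a \<Rightarrow> real) metric" where
  "bfun M = funspace (M \<times> M) euclidean_metric"

text \<open>\<open>BMet\<close> takes the value 0 off the space, \<open>funspace\<close> the value
  \<open>undefined\<close>; the restriction passes from the first convention to the second.\<close>

definition fun_of_metric :: "'a set \<Rightarrow> ('a \<Rightarrow> 'a \<Rightarrow> real) \<Rightarrow> 'a \<times> 'a \<Rightarrow> real" where
  "fun_of_metric M d = restrict (\<lambda>(x, y). d x y) (M \<times> M)"

lemma fun_of_metric_apply [simp]:
  "\<lbrakk>x \<in> M; y \<in> M\<rbrakk> \<Longrightarrow> fun_of_metric M d (x, y) = d x y"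
  by (simp add: fun_of_metric_def)

lemma mspace_bfun_iff:
  "F \<in> mspace (bfun M) \<longleftrightarrow>
     F \<in> extensional (M \<times> M) \<and> (\<exists>B. \<forall>x\<in>M. \<forall>y\<in>M. \<bar>F (x, y)\<bar> \<le> B)"
proof -
  have "bounded (F ` (M \<times> M)) \<longleftrightarrow> (\<exists>B. \<forall>x\<in>M. \<forall>y\<in>M. \<bar>F (x, y)\<bar> \<le> B)"
    by (force simp: bounded_iff)
  then show ?thesis
    by (auto simp: bfun_def Met_TC.fspace_def)
qed

lemma fun_of_metric_in_bfun:
  assumes "\<And>x y. \<lbrakk>x \<in> M; y \<in> M\<rbrakk> \<Longrightarrow> \<bar>d x y\<bar> \<le> B"
  shows "fun_of_metric M d \<in> mspace (bfun M)"
  using assms by (auto simp: mspace_bfun_iff fun_of_metric_def)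

lemma mdist_bfun_leI:
  assumes "F \<in> mspace (bfun M)" "G \<in> mspace (bfun M)" "0 \<le> c"
    and "\<And>x y. \<lbrakk>x \<in> M; y \<in> M\<rbrakk> \<Longrightarrow> \<bar>F (x, y) - G (x, y)\<bar> \<le> c"
  shows "mdist (bfun M) F G \<le> c"
proof (cases "M = {}")
  case True
  then show ?thesis
    using \<open>0 \<le> c\<close> by (simp add: bfun_def Met_TC.fdist_def)
next
  case False
  then show ?thesis
    using assms unfolding bfun_def
    by (subst funspace_mdist_le) (auto simp: dist_real_def)
qed

lemma mdist_bfun_upper:
  assumes "F \<in> mspace (bfun M)" "G \<in> mspace (bfun M)" "x \<in> M" "y \<in> M"
  shows "\<bar>F (x, y) - G (x, y)\<bar> \<le> mdist (bfun M) F G"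
proof -
  have "\<forall>p\<in>M \<times> M. mdist euclidean_metric (F p) (G p) \<le> mdist (bfun M) F G"
    using assms unfolding bfun_def by (subst funspace_mdist_le[symmetric]) auto
  then show ?thesis
    using assms by (auto simp: dist_real_def)
qed

lemma fun_of_metric_BMet:
  assumes "d \<in> BMet X"
  shows "fun_of_metric (topspace X) d \<in> mspace (bfun (topspace X))"
  using BMet_bounded[OF assms] fun_of_metric_in_bfun by metis

text \<open>Makes \<open>fun_of_metric\<close> an isometric embedding, so that complete
  metrizability of \<open>BMet X\<close> can be read off its image.\<close>

lemma mdist_fun_of_metric:
  assumes "d \<in> BMet X" "e \<in> BMet X"
  shows "mdist (bfun (topspace X)) (fun_of_metric (topspace X) d) (fun_of_metric (topspace X) e)
    = sup_metric X d e"
proof (cases "topspace X = {}")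
  case True
  then show ?thesis
    by (simp add: bfun_def Met_TC.fdist_def sup_metric_def)
next
  case False
  interpret Metric_space "BMet X" "sup_metric X"
    by (rule Metric_space_sup_metric)
  show ?thesis
  proof (rule antisym)
    show "mdist (bfun (topspace X)) (fun_of_metric (topspace X) d) (fun_of_metric (topspace X) e)
      \<le> sup_metric X d e"
      using assms by (intro mdist_bfun_leI fun_of_metric_BMet nonneg) (auto intro: sup_metric_upper)
    show "sup_metric X d e \<le>
      mdist (bfun (topspace X)) (fun_of_metric (topspace X) d) (fun_of_metric (topspace X) e)"
    proof (rule sup_metric_least[OF False assms])
      fix x y
      assume "x \<in> topspace X" "y \<in> topspace X"
      then show "\<bar>d x y - e x y\<bar> \<le>
        mdist (bfun (topspace X)) (fun_of_metric (topspace X) d) (fun_of_metric (topspace X) e)"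
        using mdist_bfun_upper[OF fun_of_metric_BMet fun_of_metric_BMet] assms
        by (metis fun_of_metric_apply)
    qed
  qed
qed

lemma completely_metrizable_bfun: "completely_metrizable_space (mtopology_of (bfun M))"
proof -
  have "mcomplete_of (bfun M)"
    using Metric_space.mcomplete_funspace[OF Met_TC.Metric_space_axioms]
      complete_UNIV
    by (simp add: bfun_def mcomplete_of_def)
  then show ?thesis
    by (metis Metric_space.completely_metrizable_space_mtopology Metric_space_mspace_mdist
        mcomplete_of_def mtopology_of_def)
qed

lemma completely_metrizable_BMet_iff_gdelta:
  "completely_metrizable_space (BMet_topology X) \<longleftrightarrow>
   gdelta_in (mtopology_of (bfun (topspace X))) (fun_of_metric (topspace X) ` BMet X)"
proof -
  let ?M = "topspace X" and ?J = "fun_of_metric (topspace X)"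
  interpret Metric_space12 "BMet X" "sup_metric X" "mspace (bfun ?M)" "mdist (bfun ?M)"
    by (simp add: Metric_space12_def Metric_space_sup_metric)
  have "embedding_map M1.mtopology M2.mtopology ?J"
    by (rule isometry_imp_embedding_map) (auto simp: fun_of_metric_BMet mdist_fun_of_metric)
  then have "BMet_topology X homeomorphic_space subtopology (mtopology_of (bfun ?M)) (?J ` BMet X)"
    unfolding BMet_topology_def mtopology_of_def
    by (metis M1.topspace_mtopology embedding_map_imp_homeomorphic_space)
  then have "completely_metrizable_space (BMet_topology X) \<longleftrightarrow>
      completely_metrizable_space (subtopology (mtopology_of (bfun ?M)) (?J ` BMet X))"
    by (rule homeomorphic_completely_metrizable_space)
  \<comment> \<open>The theorem of Alexandrov and Mazurkiewicz, inside the complete space of bounded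
    functions.\<close>
  also have "\<dots> \<longleftrightarrow> gdelta_in (mtopology_of (bfun ?M)) (?J ` BMet X)"
    by (rule completely_metrizable_space_eq_gdelta_in)
       (auto simp: completely_metrizable_bfun fun_of_metric_BMet)
  finally show ?thesis .
qed

section \<open>Sigma-compactness makes the set of metrics a G-delta set\<close>

lemma in_closure_of_fun_of_metric_BMet:
  assumes "F \<in> mtopology_of (bfun (topspace X)) closure_of (fun_of_metric (topspace X) ` BMet X)"
  shows "F \<in> mspace (bfun (topspace X))"
    and "r > 0 \<Longrightarrow> \<exists>d\<in>BMet X. \<forall>x\<in>topspace X. \<forall>y\<in>topspace X. \<bar>F (x, y) - d x y\<bar> < r"
proof -
  let ?M = "topspace X"
  interpret B: Metric_space "mspace (bfun ?M)" "mdist (bfun ?M)"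
    by simp
  show F: "F \<in> mspace (bfun ?M)"
    using assms by (simp add: in_closure_of)
  assume "r > 0"
  then obtain d where d: "d \<in> BMet X" "mdist (bfun ?M) F (fun_of_metric ?M d) < r"
    using assms unfolding mtopology_of_def B.metric_closure_of by auto
  have "\<bar>F (x, y) - d x y\<bar> < r" if "x \<in> ?M" "y \<in> ?M" for x y
    using mdist_bfun_upper[OF F fun_of_metric_BMet[OF d(1)] that] d(2) that by simp
  then show "\<exists>d\<in>BMet X. \<forall>x\<in>?M. \<forall>y\<in>?M. \<bar>F (x, y) - d x y\<bar> < r"
    using d(1) by blast
qed

text \<open>Since \<open>c\<close> is existentially quantified, half of it still serves for every
  function at uniform distance less than \<open>c / 2\<close>.\<close>

lemma openin_uniformly_separating:
  assumes "K \<subseteq> M"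
  shows "openin (mtopology_of (bfun M))
    {F \<in> mspace (bfun M). \<exists>c>0. \<forall>x\<in>K. \<forall>y\<in>M. r \<le> d x y \<longrightarrow> c \<le> F (x, y)}"
proof -
  interpret B: Metric_space "mspace (bfun M)" "mdist (bfun M)"
    by simp
  let ?U = "{F \<in> mspace (bfun M). \<exists>c>0. \<forall>x\<in>K. \<forall>y\<in>M. r \<le> d x y \<longrightarrow> c \<le> F (x, y)}"
  have "\<exists>s>0. B.mball F s \<subseteq> ?U" if "F \<in> ?U" for F
  proof -
    from that obtain c where F: "F \<in> mspace (bfun M)" and "c > 0"
      and c: "\<And>x y. \<lbrakk>x \<in> K; y \<in> M; r \<le> d x y\<rbrakk> \<Longrightarrow> c \<le> F (x, y)"
      by auto
    have "G \<in> ?U" if "G \<in> B.mball F (c / 2)" for G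
    proof -
      have G: "G \<in> mspace (bfun M)" "mdist (bfun M) F G < c / 2"
        using that by auto
      have "c / 2 \<le> G (x, y)" if "x \<in> K" "y \<in> M" "r \<le> d x y" for x y
        using mdist_bfun_upper[OF F G(1), of x y] G(2) c[OF that] that \<open>K \<subseteq> M\<close>
        by (auto simp: subset_iff abs_if split: if_splits)
      then show ?thesis
        using G(1) \<open>c > 0\<close> by (auto intro!: exI[of _ "c / 2"])
    qed
    then show ?thesis
      using \<open>c > 0\<close> by (intro exI[of _ "c / 2"]) auto
  qed
  then show ?thesis
    unfolding mtopology_of_def B.openin_mtopology by blast
qed

text \<open>Otherwise there are pairs whose \<open>e\<close>-distance tends to 0 while their
  \<open>d\<close>-distance stays at least \<open>r\<close>. By compactness the first components
  subconverge to some \<open>l\<close>, the second components follow them, and near \<open>l\<close>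
  the metric \<open>d\<close> is small as well.\<close>

lemma compact_uniformly_separated:
  assumes "Metric_space M d" "Metric_space M e"
    and eq: "Metric_space.mtopology M d = Metric_space.mtopology M e"
    and K: "compactin (Metric_space.mtopology M e) K" and "r > 0"
  shows "\<exists>c>0. \<forall>x\<in>K. \<forall>y\<in>M. r \<le> d x y \<longrightarrow> c \<le> e x y"
proof (rule ccontr)
  interpret D: Metric_space M d by fact
  interpret E: Metric_space M e by fact
  assume "\<not> ?thesis"
  moreover have "inverse (real (Suc n)) > 0" for n
    by simp
  ultimately have "\<exists>x y. x \<in> K \<and> y \<in> M \<and> r \<le> d x y \<and> e x y < inverse (real (Suc n))" for n
    by (meson not_le)
  then obtain x y where xy: "\<And>n. x n \<in> K" "\<And>n. y n \<in> M" "\<And>n. r \<le> d (x n) (y n)"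
    "\<And>n. e (x n) (y n) < inverse (real (Suc n))"
    by metis
  have "K \<subseteq> M"
    using K E.compactin_sequentially by blast
  then have xM: "x n \<in> M" for n
    using xy(1) by blast
  obtain l \<rho> where l: "l \<in> K" "strict_mono \<rho>" "limitin E.mtopology (x \<circ> \<rho>) l sequentially"
    using K xy(1) unfolding E.compactin_sequentially by (metis image_subsetI)
  have lM: "l \<in> M"
    using l(1) \<open>K \<subseteq> M\<close> by blast
  obtain s where "s > 0" and s: "\<And>z. \<lbrakk>z \<in> M; e l z < s\<rbrakk> \<Longrightarrow> d l z < r / 2"
    using mtopology_eqD[OF assms(2,1) eq[symmetric] lM, of "r / 2"] \<open>r > 0\<close> by auto
  have "\<forall>\<^sub>F n in sequentially. e (x (\<rho> n)) l < s / 2"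
  proof -
    have "\<forall>\<^sub>F n in sequentially. (x \<circ> \<rho>) n \<in> M \<and> e ((x \<circ> \<rho>) n) l < s / 2"
      using l(3) half_gt_zero[OF \<open>s > 0\<close>] unfolding E.limitin_metric by blast
    then show ?thesis
      by (rule eventually_mono) simp
  qed
  moreover have "\<forall>\<^sub>F n in sequentially. inverse (real (Suc n)) < s / 2"
    using LIMSEQ_inverse_real_of_nat \<open>s > 0\<close> by (intro order_tendstoD) auto
  ultimately have "\<forall>\<^sub>F n in sequentially. e (x (\<rho> n)) l < s / 2 \<and> inverse (real (Suc n)) < s / 2"
    by (rule eventually_conj)
  then obtain n where n: "e (x (\<rho> n)) l < s / 2" "inverse (real (Suc n)) < s / 2"
    using eventually_happens'[OF sequentially_bot] by blast
  \<comment> \<open>The bound on \<open>inverse\<close> is known at \<open>n\<close> but needed at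
    the index \<open>\<rho> n\<close> of the subsequence, which is at least
    \<open>n\<close>.\<close>
  have "inverse (real (Suc (\<rho> n))) \<le> inverse (real (Suc n))"
    using seq_suble[OF l(2), of n] by simp
  then have "e (x (\<rho> n)) (y (\<rho> n)) < s / 2"
    using xy(4)[of "\<rho> n"] n by linarith
  then have "e l (y (\<rho> n)) < s"
    using n(1) E.triangle[OF lM xM xy(2), of "\<rho> n" "\<rho> n"] E.commute[of l] by auto
  moreover have "e l (x (\<rho> n)) < s"
    using n(1) E.commute[of l] \<open>s > 0\<close> by auto
  ultimately have "d (x (\<rho> n)) (y (\<rho> n)) < r"
    using s[OF xM, of "\<rho> n"] s[OF xy(2), of "\<rho> n"] D.triangle[OF xM lM xy(2), of "\<rho> n" "\<rho> n"]
      D.commute[of l] by auto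
  then show False
    using xy(3)[of "\<rho> n"] by simp
qed

lemma BMet_I:
  assumes "Metric_space (topspace X) d" "Metric_space.mtopology (topspace X) d = X"
    and "\<And>x y. \<lbrakk>x \<in> topspace X; y \<in> topspace X\<rbrakk> \<Longrightarrow> d x y \<le> B"
    and "\<And>x y. x \<notin> topspace X \<or> y \<notin> topspace X \<Longrightarrow> d x y = 0"
  shows "d \<in> BMet X"
proof -
  interpret Metric_space "topspace X" d by fact
  have "mbounded (topspace X)"
    unfolding mbounded_alt using assms(3) by blast
  then show ?thesis
    using assms by (simp add: BMet_def)
qed

text \<open>The limit of metrics in \<open>BMet X\<close> is a continuous pseudometric; it induces the topology once
  it is bounded below on every pair at a fixed distance with one point in one of the compact sets.\<close>

lemma gdelta_BMet:
  assumes "metrizable_space X" "sigma_compact_space X"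
  shows "gdelta_in (mtopology_of (bfun (topspace X))) (fun_of_metric (topspace X) ` BMet X)"
proof -
  define M where "M = topspace X"
  let ?J = "fun_of_metric M"
  let ?Y = "mtopology_of (bfun M)"
  obtain d where d: "Metric_space M d" "Metric_space.mtopology M d = X"
    using assms(1) Metric_space.topspace_mtopology unfolding metrizable_space_def M_def by metis
  interpret D: Metric_space M d by fact
  obtain \<K> where \<K>: "countable \<K>" "\<And>K. K \<in> \<K> \<Longrightarrow> compactin X K" "\<Union>\<K> = M"
    using assms(2) by (auto simp: sigma_compact_space_def M_def)
  \<comment> \<open>The index \<open>n\<close> encodes the distance 1/(n+1), so that the family of
    open conditions is countable.\<close>
  define U where "U = (\<lambda>(K, n::nat). {F \<in> mspace (bfun M).
    \<exists>c>0. \<forall>x\<in>K. \<forall>y\<in>M. inverse (real (Suc n)) \<le> d x y \<longrightarrow> c \<le> F (x, y)})"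
  define C where "C = ?Y closure_of (?J ` BMet X)"
  have KM: "K \<subseteq> M" if "K \<in> \<K>" for K
    using that \<K>(3) by blast
  have "gdelta_in ?Y C"
    unfolding C_def mtopology_of_def
    using Metric_space.metrizable_space_mtopology[OF Metric_space_mspace_mdist]
    by (intro closed_imp_gdelta_in) auto
  moreover have "gdelta_in ?Y (U p)" if "p \<in> \<K> \<times> UNIV" for p
    using that by (auto simp: U_def intro!: open_imp_gdelta_in openin_uniformly_separating KM)
  ultimately have gdelta: "gdelta_in ?Y (\<Inter> (insert C (U ` (\<K> \<times> UNIV))))"
    using \<K>(1) by (intro gdelta_in_Inter) auto
  have "?J e \<in> C \<inter> U (K, n)" if e: "e \<in> BMet X" and K: "K \<in> \<K>" for e K n
  proof -
    have e': "Metric_space M e" "Metric_space.mtopology M e = X"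
      using e by (auto simp: BMet_def M_def)
    have "?J e \<in> C"
      using e fun_of_metric_BMet[OF e] unfolding C_def
      by (metis M_def closure_of_subset image_subset_iff topspace_mtopology_of fun_of_metric_BMet)
    moreover have "\<exists>c>0. \<forall>x\<in>K. \<forall>y\<in>M. inverse (real (Suc n)) \<le> d x y \<longrightarrow> c \<le> e x y"
      using d e' \<K>(2)[OF K] by (intro compact_uniformly_separated) auto
    ultimately show ?thesis
      using fun_of_metric_BMet[OF e] KM[OF K] by (auto simp: U_def M_def subset_iff)
  qed
  moreover have "F \<in> ?J ` BMet X" if FC: "F \<in> C" and FU: "\<And>K n. K \<in> \<K> \<Longrightarrow> F \<in> U (K, n)" for F
  proof -
    have F: "F \<in> mspace (bfun M)"
      using in_closure_of_fun_of_metric_BMet(1)[of F X] FC by (simp add: C_def M_def)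
    have approx: "\<exists>e\<in>BMet X. \<forall>x\<in>M. \<forall>y\<in>M. \<bar>F (x, y) - e x y\<bar> < r" if "r > 0" for r
      using in_closure_of_fun_of_metric_BMet(2)[of F X r] FC that by (simp add: C_def M_def)
    \<comment> \<open>The candidate preimage of \<open>F\<close>, with the value 0 off
      \<open>M\<close> that \<open>BMet\<close> demands.\<close>
    define f where "f = (\<lambda>x y. if x \<in> M \<and> y \<in> M then F (x, y) else 0)"
    have approx_f: "\<exists>e. e \<in> BMet X \<and> Metric_space M e \<and> (\<forall>x y. x \<in> M \<longrightarrow> y \<in> M \<longrightarrow> \<bar>f x y - e x y\<bar> < r)"
      if "r > 0" for r
      using approx[OF that] by (auto simp: f_def BMet_def M_def)
    \<comment> \<open>For a single point, one compact set containing it and one \<open>n\<close>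
      with 1/(n+1) below \<open>r\<close> suffice.\<close>
    have sep: "\<exists>c>0. \<forall>y\<in>M. r \<le> d x y \<longrightarrow> c \<le> f x y" if x: "x \<in> M" and "r > 0" for x r
    proof -
      obtain n where n: "inverse (real (Suc n)) < r"
        using \<open>r > 0\<close> reals_Archimedean by blast
      obtain K where K: "K \<in> \<K>" "x \<in> K"
        using x \<K>(3) by blast
      then obtain c where "c > 0" "\<And>y. \<lbrakk>y \<in> M; inverse (real (Suc n)) \<le> d x y\<rbrakk> \<Longrightarrow> c \<le> F (x, y)"
        using FU[OF K(1), of n] by (auto simp: U_def)
      then show ?thesis
        using x n by (intro exI[of _ c]) (auto simp: f_def)
    qed
    have nonneg: "0 \<le> f x y" for x y
    proof (rule ccontr)
      assume neg: "\<not> 0 \<le> f x y"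
      then have "x \<in> M" "y \<in> M"
        by (auto simp: f_def split: if_splits)
      then obtain e where e: "Metric_space M e" "\<bar>f x y - e x y\<bar> < - f x y"
        using approx_f[of "- f x y"] neg by auto
      then show False
        using Metric_space.nonneg[OF e(1), of x y] by linarith
    qed
    have refl: "f x x = 0" if x: "x \<in> M" for x
    proof (rule ccontr)
      assume "f x x \<noteq> 0"
      then obtain e where e: "Metric_space M e" "\<bar>f x x - e x x\<bar> < f x x"
        using approx_f[of "f x x"] nonneg[of x x] x by force
      then show False
        using Metric_space.zero[OF e(1) x x] by auto
    qed
    have "Metric_space M f"
    proof
      show "0 \<le> f x y" for x y
        by (rule nonneg)
      show "f x y = f y x" for x y
      proof (rule ccontr)
        assume ne: "f x y \<noteq> f y x"
        then have "x \<in> M" "y \<in> M"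
          by (auto simp: f_def split: if_splits)
        then obtain e where e: "Metric_space M e" "\<bar>f x y - e x y\<bar> < \<bar>f x y - f y x\<bar> / 2"
          "\<bar>f y x - e y x\<bar> < \<bar>f x y - f y x\<bar> / 2"
          using approx_f[of "\<bar>f x y - f y x\<bar> / 2"] ne by auto
        have "\<bar>f x y - f y x\<bar> \<le> \<bar>f x y - e x y\<bar> + \<bar>f y x - e y x\<bar>"
          using Metric_space.commute[OF e(1), of x y] by linarith
        then show False
          using e(2,3) by simp
      qed
      show "f x y = 0 \<longleftrightarrow> x = y" if "x \<in> M" "y \<in> M" for x y
      proof
        assume 0: "f x y = 0"
        show "x = y"
        proof (rule ccontr)
          assume "x \<noteq> y"
          then have "d x y > 0"
            using that by simp
          then show False
            using sep[of x "d x y"] that 0 by force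
        qed
      qed (use refl that in auto)
      show "f x z \<le> f x y + f y z" if xyz: "x \<in> M" "y \<in> M" "z \<in> M" for x y z
      proof (rule ccontr)
        assume neg: "\<not> f x z \<le> f x y + f y z"
        \<comment> \<open>A violation by \<open>3 * r\<close> survives three approximation errors
          below \<open>r\<close> and contradicts the triangle inequality of
          \<open>e\<close>.\<close>
        define r where "r = (f x z - f x y - f y z) / 3"
        have r: "3 * r = f x z - f x y - f y z"
          by (simp add: r_def)
        then have "r > 0"
          using neg by linarith
        obtain e where e: "Metric_space M e" "\<bar>f x y - e x y\<bar> < r" "\<bar>f y z - e y z\<bar> < r"
          "\<bar>f x z - e x z\<bar> < r"
          using approx_f[OF \<open>r > 0\<close>] xyz by blast
        have "f x z < e x z + r" "e x y < f x y + r" "e y z < f y z + r"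
          using e(2-4) by linarith+
        then show False
          using Metric_space.triangle[OF e(1) xyz] r by linarith
      qed
    qed
    then interpret f: Metric_space M f .
    \<comment> \<open>One direction is \<open>sep\<close>. For the other, a single metric
      \<open>e\<close> of \<open>X\<close> uniformly within \<open>r / 2\<close> of \<open>f\<close>
      suffices, because \<open>e\<close> is continuous for \<open>d\<close>.\<close>
    have "f.mtopology = D.mtopology"
    proof (rule mtopology_eqI[OF \<open>Metric_space M f\<close> d(1)])
      show "\<exists>s>0. \<forall>y\<in>M. f x y < s \<longrightarrow> d x y < r" if "x \<in> M" "r > 0" for x r
        using sep[OF that] by (auto simp flip: not_le)
      show "\<exists>s>0. \<forall>y\<in>M. d x y < s \<longrightarrow> f x y < r" if xr: "x \<in> M" "r > 0" for x r
      proof -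
        obtain e where e: "e \<in> BMet X" "Metric_space M e"
          and fe: "\<And>x y. \<lbrakk>x \<in> M; y \<in> M\<rbrakk> \<Longrightarrow> \<bar>f x y - e x y\<bar> < r / 2"
          using approx_f[of "r / 2"] \<open>r > 0\<close> by auto
        have "D.mtopology = Metric_space.mtopology M e"
          using e d by (simp add: BMet_def M_def)
        then obtain s where "s > 0" and s: "\<And>y. \<lbrakk>y \<in> M; d x y < s\<rbrakk> \<Longrightarrow> e x y < r / 2"
          using mtopology_eqD[OF d(1) e(2), of x "r / 2"] xr by auto
        have "f x y < r" if "y \<in> M" "d x y < s" for y
          using s[OF that] fe[OF xr(1) that(1)] by linarith
        then show ?thesis
          using \<open>s > 0\<close> by blast
      qed
    qed
    moreover obtain B where "\<And>x y. \<lbrakk>x \<in> M; y \<in> M\<rbrakk> \<Longrightarrow> \<bar>F (x, y)\<bar> \<le> B"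
      using F by (auto simp: mspace_bfun_iff)
    ultimately have "f \<in> BMet X"
      using d(2) f.Metric_space_axioms
      by (intro BMet_I[where B = B]) (auto simp: f_def M_def abs_le_iff)
    moreover have "?J f = F"
      using F by (auto simp: fun_of_metric_def f_def mspace_bfun_iff intro!: extensionalityI[of _ "M \<times> M"])
    ultimately show ?thesis
      by blast
  qed
  moreover have "?J e \<in> C" if "e \<in> BMet X" for e
    unfolding C_def using that
    by (metis M_def closure_of_subset image_subset_iff topspace_mtopology_of fun_of_metric_BMet)
  ultimately have "?J ` BMet X = \<Inter> (insert C (U ` (\<K> \<times> UNIV)))"
    by (intro subset_antisym subsetI) (blast, simp)
  then show ?thesis
    using gdelta by (simp add: M_def)
qed

subsection \<open>Shortcut metrics\<close>

text \<open>The metric obtained by adding a point at distance \<open>f x\<close> from each \<open>x\<close>.\<close>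

definition shortcut :: "'a set \<Rightarrow> ('a \<Rightarrow> 'a \<Rightarrow> real) \<Rightarrow> ('a \<Rightarrow> real) \<Rightarrow> 'a \<Rightarrow> 'a \<Rightarrow> real" where
  "shortcut M d f x y = (if x \<in> M \<and> y \<in> M \<and> x \<noteq> y then min (d x y) (f x + f y) else 0)"

text \<open>In the triangle inequality, one direct leg and one leg through the added point are
  handled by \<open>lip\<close>; two legs through it leave \<open>2 * f y\<close> to spare.
  Positivity of \<open>f\<close> keeps distinct points apart.\<close>

lemma Metric_space_shortcut:
  assumes "Metric_space M d" and pos: "\<And>x. x \<in> M \<Longrightarrow> f x > 0"
    and lip: "\<And>x y. \<lbrakk>x \<in> M; y \<in> M\<rbrakk> \<Longrightarrow> f x \<le> f y + d x y"
  shows "Metric_space M (shortcut M d f)"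
proof -
  interpret Metric_space M d by fact
  show ?thesis
  proof
    show "0 \<le> shortcut M d f x y" for x y
      using pos[of x] pos[of y] by (auto simp: shortcut_def)
    show "shortcut M d f x y = shortcut M d f y x" for x y
      by (cases "x = y") (auto simp: shortcut_def commute[of y x] add.commute)
    show "shortcut M d f x y = 0 \<longleftrightarrow> x = y" if "x \<in> M" "y \<in> M" for x y
      using pos[of x] pos[of y] that by (auto simp: shortcut_def min_def)
    show "shortcut M d f x z \<le> shortcut M d f x y + shortcut M d f y z"
      if "x \<in> M" "y \<in> M" "z \<in> M" for x y z
      using that pos[OF that(1)] pos[OF that(2)] pos[OF that(3)] triangle[OF that]
        lip[OF that(1,2)] lip[OF that(3,2)] commute[of z y] nonneg[of x z]
      by (auto simp: shortcut_def min_def commute)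
  qed
qed

text \<open>A detour from \<open>x\<close> costs more than \<open>f x\<close>, so below that
  distance the new metric agrees with \<open>d\<close>.\<close>

lemma mtopology_shortcut:
  assumes "Metric_space M d" and pos: "\<And>x. x \<in> M \<Longrightarrow> f x > 0"
    and lip: "\<And>x y. \<lbrakk>x \<in> M; y \<in> M\<rbrakk> \<Longrightarrow> f x \<le> f y + d x y"
  shows "Metric_space.mtopology M (shortcut M d f) = Metric_space.mtopology M d"
proof (rule mtopology_eqI[OF Metric_space_shortcut[OF assms] assms(1)])
  interpret Metric_space M d by fact
  show "\<exists>s>0. \<forall>y\<in>M. shortcut M d f x y < s \<longrightarrow> d x y < r" if "x \<in> M" "r > 0" for x r
  proof (intro exI[of _ "min r (f x)"] conjI ballI impI)
    show "0 < min r (f x)"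
      using that pos by simp
    show "d x y < r" if "y \<in> M" "shortcut M d f x y < min r (f x)" for y
      using that \<open>x \<in> M\<close> \<open>r > 0\<close> pos[OF \<open>y \<in> M\<close>] by (auto simp: shortcut_def min_def split: if_splits)
  qed
  show "\<exists>s>0. \<forall>y\<in>M. d x y < s \<longrightarrow> shortcut M d f x y < r" if "x \<in> M" "r > 0" for x r
    using that by (intro exI[of _ r]) (auto simp: shortcut_def)
qed

lemma abs_shortcut_le:
  assumes "\<And>x. x \<in> M \<Longrightarrow> 0 \<le> f x" "\<And>x. x \<in> M \<Longrightarrow> f x \<le> B" "Metric_space M d" "x \<in> M" "y \<in> M"
  shows "\<bar>shortcut M d f x y\<bar> \<le> 2 * B"
  using assms(1,2)[OF \<open>x \<in> M\<close>] assms(1,2)[OF \<open>y \<in> M\<close>] Metric_space.nonneg[OF assms(3), of x y]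
  by (auto simp: shortcut_def min_def abs_if)

lemma shortcut_in_BMet:
  assumes "Metric_space (topspace X) d" "Metric_space.mtopology (topspace X) d = X"
    and "\<And>x. x \<in> topspace X \<Longrightarrow> f x > 0" "\<And>x. x \<in> topspace X \<Longrightarrow> f x \<le> B"
    and "\<And>x y. \<lbrakk>x \<in> topspace X; y \<in> topspace X\<rbrakk> \<Longrightarrow> f x \<le> f y + d x y"
  shows "shortcut (topspace X) d f \<in> BMet X"
proof -
  interpret S: Metric_space "topspace X" "shortcut (topspace X) d f"
    by (rule Metric_space_shortcut) (use assms in auto)
  show ?thesis
  proof (rule BMet_I[where B = "2 * B"])
    show "Metric_space.mtopology (topspace X) (shortcut (topspace X) d f) = X"
      using mtopology_shortcut[of "topspace X" d f] assms by simp
    show "shortcut (topspace X) d f x y \<le> 2 * B" if "x \<in> topspace X" "y \<in> topspace X" for x y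
      using abs_shortcut_le[of "topspace X" f B d x y] assms that by (auto simp: less_imp_le)
  qed (auto simp: shortcut_def S.Metric_space_axioms)
qed

text \<open>Along points where \<open>q\<close> tends to \<open>0\<close>, which cannot converge since \<open>q\<close> is positive,
  the shortcut distance to a zero of \<open>f\<close> tends to \<open>0\<close>.\<close>

lemma shortcut_notin_BMet:
  assumes "Metric_space (topspace X) d" "Metric_space.mtopology (topspace X) d = X"
    and q_pos: "\<And>x. x \<in> topspace X \<Longrightarrow> q x > 0"
    and q_lip: "\<And>x y. \<lbrakk>x \<in> topspace X; y \<in> topspace X\<rbrakk> \<Longrightarrow> q x \<le> q y + d x y"
    and q_inf: "\<And>r. r > 0 \<Longrightarrow> \<exists>x\<in>topspace X. q x < r"
    and f_le: "\<And>x. x \<in> topspace X \<Longrightarrow> f x \<le> q x"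
    and p: "p \<in> topspace X" "f p = 0"
  shows "fun_of_metric (topspace X) (shortcut (topspace X) d f) \<notin> fun_of_metric (topspace X) ` BMet X"
proof
  assume "fun_of_metric (topspace X) (shortcut (topspace X) d f) \<in> fun_of_metric (topspace X) ` BMet X"
  then obtain e where e: "e \<in> BMet X"
    and eq: "fun_of_metric (topspace X) (shortcut (topspace X) d f) = fun_of_metric (topspace X) e"
    by blast
  \<comment> \<open>From the zero \<open>p\<close> the detour to \<open>y\<close> costs only
    \<open>f y\<close>, which is at most \<open>q y\<close>.\<close>
  have e_le: "e p y \<le> q y" if "y \<in> topspace X" for y
  proof -
    have "e p y = shortcut (topspace X) d f p y"
      using eq p that by (metis fun_of_metric_apply)
    also have "\<dots> \<le> q y"
      using p that f_le[OF that] less_imp_le[OF q_pos[OF that]] by (auto simp: shortcut_def)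
    finally show ?thesis .
  qed
  \<comment> \<open>If \<open>e\<close> induced the topology, a point \<open>y\<close> with
    \<open>q y\<close> small would be \<open>d\<close>-close to \<open>p\<close>. Then
    \<open>q p\<close> would be less than \<open>q p / 2 + q p / 2\<close>, since \<open>q\<close>
    is 1-Lipschitz.\<close>
  have "Metric_space (topspace X) e" "Metric_space.mtopology (topspace X) e = X"
    using e by (auto simp: BMet_def)
  then obtain s where "s > 0" and s: "\<And>y. \<lbrakk>y \<in> topspace X; e p y < s\<rbrakk> \<Longrightarrow> d p y < q p / 2"
    using mtopology_eqD[of "topspace X" e d p "q p / 2"] assms(1,2) p q_pos[OF p(1)] by auto
  have "min s (q p / 2) > 0"
    using \<open>s > 0\<close> q_pos[OF p(1)] by simp
  then obtain y where y: "y \<in> topspace X" "q y < min s (q p / 2)"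
    using q_inf by blast
  then have "d p y < q p / 2"
    using s[OF y(1)] e_le[OF y(1)] by simp
  then show False
    using q_lip[OF p(1) y(1)] y(2) by simp
qed

lemma abs_shortcut_diff_le:
  assumes "\<And>x. x \<in> M \<Longrightarrow> \<bar>f x - g x\<bar> \<le> c" "0 \<le> c" "x \<in> M" "y \<in> M"
  shows "\<bar>shortcut M d f x y - shortcut M d g x y\<bar> \<le> 2 * c"
  using assms(1)[OF \<open>x \<in> M\<close>] assms(1)[OF \<open>y \<in> M\<close>] assms(2)
  by (auto simp: shortcut_def min_def abs_if split: if_splits)

section \<open>F-sigma sets of parameters\<close>

lemma gdelta_in_continuous_map_preimage:
  assumes "continuous_map X Y f" "gdelta_in Y S"
  shows "gdelta_in X {x \<in> topspace X. f x \<in> S}"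
proof -
  obtain C :: "nat \<Rightarrow> _" where C: "\<And>n. openin Y (C n)" "\<Inter> (range C) = S"
    using assms(2) unfolding gdelta_in_descending by blast
  have "gdelta_in X (\<Inter> (range (\<lambda>n. {x \<in> topspace X. f x \<in> C n})))"
    using assms(1) C(1)
    by (intro gdelta_in_Inter) (auto intro!: open_imp_gdelta_in openin_continuous_map_preimage)
  also have "\<Inter> (range (\<lambda>n. {x \<in> topspace X. f x \<in> C n})) = {x \<in> topspace X. f x \<in> S}"
    using C(2) by auto
  finally show ?thesis .
qed

lemma fsigma_inE:
  assumes "fsigma_in X S"
  obtains \<C> where "countable \<C>" "\<And>C. C \<in> \<C> \<Longrightarrow> closedin X C" "\<Union>\<C> = S"
proof -
  obtain C :: "nat \<Rightarrow> _" where "\<And>n. closedin X (C n)" "\<Union> (range C) = S"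
    using assms unfolding fsigma_in_ascending by blast
  then show thesis
    by (intro that[of "range C"]) auto
qed

text \<open>The map from \<open>z\<close> to the shortcut metric of \<open>f z\<close> is
  2-Lipschitz, and its value leaves \<open>BMet X\<close> exactly when \<open>f z\<close> has a
  zero; the preimage of a G-delta set is G-delta. The bound \<open>B\<close> makes the shortcut
  metrics bounded even if \<open>d\<close> is not.\<close>

lemma fsigma_zeros:
  assumes gdelta: "gdelta_in (mtopology_of (bfun (topspace X))) (fun_of_metric (topspace X) ` BMet X)"
    and d: "Metric_space (topspace X) d" "Metric_space.mtopology (topspace X) d = X"
    and q_pos: "\<And>x. x \<in> topspace X \<Longrightarrow> q x > 0"
    and q_lip: "\<And>x y. \<lbrakk>x \<in> topspace X; y \<in> topspace X\<rbrakk> \<Longrightarrow> q x \<le> q y + d x y"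
    and q_inf: "\<And>r. r > 0 \<Longrightarrow> \<exists>x\<in>topspace X. q x < r"
    and q_le: "\<And>x. x \<in> topspace X \<Longrightarrow> q x \<le> B"
    and Z: "Metric_space Z \<delta>"
    and f_nonneg: "\<And>z x. \<lbrakk>z \<in> Z; x \<in> topspace X\<rbrakk> \<Longrightarrow> 0 \<le> f z x"
    and f_le: "\<And>z x. \<lbrakk>z \<in> Z; x \<in> topspace X\<rbrakk> \<Longrightarrow> f z x \<le> q x"
    and f_lip: "\<And>z x y. \<lbrakk>z \<in> Z; x \<in> topspace X; y \<in> topspace X\<rbrakk> \<Longrightarrow> f z x \<le> f z y + d x y"
    and f_cont: "\<And>z w x. \<lbrakk>z \<in> Z; w \<in> Z; x \<in> topspace X\<rbrakk> \<Longrightarrow> f z x \<le> f w x + \<delta> z w"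
  shows "fsigma_in (Metric_space.mtopology Z \<delta>) {z \<in> Z. \<exists>x\<in>topspace X. f z x = 0}"
proof -
  interpret Z: Metric_space Z \<delta> by fact
  interpret B: Metric_space "mspace (bfun (topspace X))" "mdist (bfun (topspace X))"
    by simp
  define g where "g = (\<lambda>z. fun_of_metric (topspace X) (shortcut (topspace X) d (f z)))"
  have f_bound: "f z x \<le> B" if "z \<in> Z" "x \<in> topspace X" for z x
    using f_le[OF that] q_le[OF that(2)] by linarith
  have g: "g z \<in> mspace (bfun (topspace X))" if "z \<in> Z" for z
    unfolding g_def
    by (rule fun_of_metric_in_bfun[where B = "2 * B"], rule abs_shortcut_le)
       (use that f_nonneg f_bound d in auto)
  have g_dist: "mdist (bfun (topspace X)) (g z) (g w) \<le> 2 * \<delta> z w" if zw: "z \<in> Z" "w \<in> Z" for z w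
  proof (rule mdist_bfun_leI[OF g[OF zw(1)] g[OF zw(2)]])
    fix x y
    assume xy: "x \<in> topspace X" "y \<in> topspace X"
    have "\<bar>f z u - f w u\<bar> \<le> \<delta> z w" if "u \<in> topspace X" for u
      using f_cont[OF zw that] f_cont[OF zw(2,1) that] Z.commute[of z w] by linarith
    then show "\<bar>g z (x, y) - g w (x, y)\<bar> \<le> 2 * \<delta> z w"
      using abs_shortcut_diff_le[of "topspace X" "f z" "f w" "\<delta> z w" x y d] xy
      by (simp add: g_def)
  qed simp
  have "continuous_map Z.mtopology B.mtopology g"
    unfolding B.continuous_map_to_metric
  proof (intro ballI allI impI)
    fix z r
    assume z: "z \<in> topspace Z.mtopology" and "0 < (r::real)"
    have "g w \<in> B.mball (g z) r" if "w \<in> Z.mball z (r / 2)" for w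
      using g g_dist[of z w] that by auto
    then show "\<exists>U. openin Z.mtopology U \<and> z \<in> U \<and> (\<forall>w\<in>U. g w \<in> B.mball (g z) r)"
      using z \<open>0 < r\<close> by (intro exI[of _ "Z.mball z (r / 2)"]) auto
  qed
  then have "gdelta_in Z.mtopology
      {z \<in> topspace Z.mtopology. g z \<in> fun_of_metric (topspace X) ` BMet X}"
    using gdelta gdelta_in_continuous_map_preimage by (metis mtopology_of_def)
  moreover have "g z \<in> fun_of_metric (topspace X) ` BMet X \<longleftrightarrow> (\<forall>x\<in>topspace X. f z x \<noteq> 0)"
    if z: "z \<in> Z" for z
  proof
    assume "g z \<in> fun_of_metric (topspace X) ` BMet X"
    then show "\<forall>x\<in>topspace X. f z x \<noteq> 0"
      using shortcut_notin_BMet[OF d q_pos q_lip q_inf f_le[OF z]] unfolding g_def by blast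
  next
    assume "\<forall>x\<in>topspace X. f z x \<noteq> 0"
    then have "f z x > 0" if "x \<in> topspace X" for x
      using f_nonneg[OF z that] that by force
    then have "shortcut (topspace X) d (f z) \<in> BMet X"
      using f_bound[OF z] f_lip[OF z] by (intro shortcut_in_BMet[OF d, where B = B]) auto
    then show "g z \<in> fun_of_metric (topspace X) ` BMet X"
      unfolding g_def by blast
  qed
  ultimately have "gdelta_in Z.mtopology {z \<in> Z. \<forall>x\<in>topspace X. f z x \<noteq> 0}"
    by (simp cong: conj_cong)
  moreover have "Z - {z \<in> Z. \<exists>x\<in>topspace X. f z x = 0} = {z \<in> Z. \<forall>x\<in>topspace X. f z x \<noteq> 0}"
    by blast
  ultimately show ?thesis
    unfolding fsigma_in_gdelta_in by auto
qed

subsection \<open>Separable spaces\<close>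

text \<open>The distances to the points of a countable dense set embed the space into a power of
  \<open>{0..1}\<close>.\<close>

lemma countable_dense_imp_embedding_compact:
  fixes M :: "'a set"
  assumes "Metric_space M d" and A: "countable A" "A \<subseteq> M"
    and dense: "\<And>x r. \<lbrakk>x \<in> M; r > 0\<rbrakk> \<Longrightarrow> \<exists>a\<in>A. d x a < r"
  obtains Z \<delta> j where "Metric_space Z \<delta>" "compact_space (Metric_space.mtopology Z \<delta> :: ('a \<Rightarrow> real) topology)"
    "j ` M \<subseteq> Z" "Metric_space M (\<lambda>x y. \<delta> (j x) (j y))"
    "Metric_space.mtopology M (\<lambda>x y. \<delta> (j x) (j y)) = Metric_space.mtopology M d"
proof -
  interpret Metric_space M d by fact
  define P where "P = product_topology (\<lambda>_. top_of_set {0..1::real}) A"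
  have "metrizable_space P"
    unfolding P_def metrizable_space_product_topology
    using A(1) by (auto intro: metrizable_space_subtopology metrizable_space_euclidean)
  then obtain Z \<delta> where Z: "Metric_space Z \<delta>" and P: "P = Metric_space.mtopology Z \<delta>"
    unfolding metrizable_space_def by blast
  interpret Z: Metric_space Z \<delta> by fact
  have "compact_space P"
    unfolding P_def compact_space_product_topology by (simp add: compact_space_subtopology)
  define j where "j = (\<lambda>x. \<lambda>a\<in>A. min 1 (d x a))"
  have topspace_P: "topspace P = Z"
    by (simp add: P)
  have jZ: "j x \<in> Z" for x
    unfolding topspace_P[symmetric] P_def j_def by (auto simp: PiE_iff)
  have "continuous_map mtopology P j"
    unfolding P_def j_def
  proof (subst continuous_map_componentwise, intro conjI ballI)
    fix a
    assume "a \<in> A"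
    then have a: "a \<in> M"
      using A(2) by blast
    have "continuous_map mtopology euclideanreal (\<lambda>x. d x a)"
      using a continuous_map_mdist[of mtopology Self "\<lambda>x. x" "\<lambda>_. a"] by (simp add: mtopology_of_def)
    then have "continuous_map mtopology euclideanreal (\<lambda>x. min 1 (d x a))"
      by (intro continuous_map_real_min) auto
    then show "continuous_map mtopology (top_of_set {0..1}) (\<lambda>x. (\<lambda>a\<in>A. min 1 (d x a)) a)"
      using \<open>a \<in> A\<close> by (auto simp: continuous_map_in_subtopology)
  qed auto
  have cont: "\<exists>s>0. \<forall>y\<in>M. d x y < s \<longrightarrow> \<delta> (j x) (j y) < r" if xr: "x \<in> M" "r > 0" for x r
  proof -
    have "openin mtopology {y \<in> topspace mtopology. j y \<in> Z.mball (j x) r}"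
      using \<open>continuous_map mtopology P j\<close> by (rule openin_continuous_map_preimage) (simp add: P)
    moreover have "x \<in> {y \<in> topspace mtopology. j y \<in> Z.mball (j x) r}"
      using xr jZ by simp
    ultimately obtain s where "s > 0" "mball x s \<subseteq> {y \<in> topspace mtopology. j y \<in> Z.mball (j x) r}"
      unfolding openin_mtopology by blast
    then show ?thesis
      using xr by (intro exI[of _ s]) (auto simp: subset_iff)
  qed
  have inv: "\<exists>s>0. \<forall>y\<in>M. \<delta> (j x) (j y) < s \<longrightarrow> d x y < r" if xr: "x \<in> M" "r > 0" for x r
  proof -
    \<comment> \<open>With \<open>\<rho> < 1\<close>, a coordinate \<open>min 1 (d y a)\<close>
      below \<open>\<rho>\<close> is not truncated; with \<open>2 * \<rho> \<le> r\<close>, the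
      triangle inequality through \<open>a\<close> gives the bound \<open>r\<close>.\<close>
    define \<rho> where "\<rho> = min 1 r / 2"
    have \<rho>: "0 < \<rho>" "\<rho> < 1" "2 * \<rho> \<le> r"
      using xr(2) by (auto simp: \<rho>_def)
    obtain a where a: "a \<in> A" "d x a < \<rho>"
      using dense[OF xr(1) \<rho>(1)] by blast
    have aM: "a \<in> M"
      using a(1) A(2) by blast
    have "continuous_map P (top_of_set {0..1}) (\<lambda>p. p a)"
      unfolding P_def using a(1) by (rule continuous_map_product_projection)
    then have "openin P {p \<in> topspace P. p a \<in> {..<\<rho>}}"
      by (intro openin_continuous_map_preimage[where Y = euclideanreal])
         (auto simp: continuous_map_in_subtopology)
    moreover have "j x \<in> {p \<in> topspace P. p a \<in> {..<\<rho>}}"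
      using a jZ by (auto simp: topspace_P j_def)
    ultimately obtain s where "s > 0" and s: "Z.mball (j x) s \<subseteq> {p \<in> topspace P. p a \<in> {..<\<rho>}}"
      unfolding P Z.openin_mtopology by blast
    have "d x y < r" if y: "y \<in> M" "\<delta> (j x) (j y) < s" for y
    proof -
      have "j y \<in> Z.mball (j x) s"
        using jZ y(2) by simp
      then have "j y a < \<rho>"
        using s by blast
      then have "d y a < \<rho>"
        using a(1) \<rho>(2) by (auto simp: j_def min_def split: if_splits)
      then show ?thesis
        using a(2) triangle[OF xr(1) aM y(1)] commute[of a y] \<rho>(3) by linarith
    qed
    then show ?thesis
      using \<open>s > 0\<close> by blast
  qed
  have "Metric_space M (\<lambda>x y. \<delta> (j x) (j y))"
  proof
    show "\<delta> (j x) (j y) = 0 \<longleftrightarrow> x = y" if "x \<in> M" "y \<in> M" for x y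
    proof
      assume "\<delta> (j x) (j y) = 0"
      then have "d x y < r" if "r > 0" for r
        using inv[OF \<open>x \<in> M\<close> that] \<open>y \<in> M\<close> by auto
      then show "x = y"
        using that by (metis less_irrefl mdist_pos_less)
    qed (use jZ in auto)
  qed (use jZ in \<open>auto simp: Z.commute intro: Z.triangle\<close>)
  moreover from this have "Metric_space.mtopology M (\<lambda>x y. \<delta> (j x) (j y)) = mtopology"
    using cont inv by (intro mtopology_eqI) (auto intro: Metric_space_axioms)
  ultimately show thesis
    using that[of Z \<delta> j] Z \<open>compact_space P\<close> jZ by (auto simp: P)
qed

text \<open>For \<open>z\<^sub>0\<close> in the remainder of the compactification, the zeros of
  \<open>\<lambda>x. min (\<delta> (j x) z) (\<delta> (j x) z\<^sub>0)\<close> show that \<open>j ` M\<close> is an F-sigma set.\<close>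

lemma separable_gdelta_imp_sigma_compact:
  assumes gdelta: "gdelta_in (mtopology_of (bfun (topspace X))) (fun_of_metric (topspace X) ` BMet X)"
    and d: "Metric_space (topspace X) d" "Metric_space.mtopology (topspace X) d = X"
    and A: "countable A" "A \<subseteq> topspace X"
      "\<And>x r. \<lbrakk>x \<in> topspace X; r > 0\<rbrakk> \<Longrightarrow> \<exists>a\<in>A. d x a < r"
  shows "sigma_compact_space X"
proof -
  let ?M = "topspace X"
  obtain Z \<delta> and j :: "'a \<Rightarrow> 'a \<Rightarrow> real" where Z: "Metric_space Z \<delta>"
    and compact: "compact_space (Metric_space.mtopology Z \<delta>)"
    and jZ: "j ` ?M \<subseteq> Z" and e: "Metric_space ?M (\<lambda>x y. \<delta> (j x) (j y))"
    and eX: "Metric_space.mtopology ?M (\<lambda>x y. \<delta> (j x) (j y)) = X"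
    using countable_dense_imp_embedding_compact[OF d(1) A] d(2) by metis
  interpret Metric_space12 ?M "\<lambda>x y. \<delta> (j x) (j y)" Z \<delta>
    using Z e by (simp add: Metric_space12_def)
  have jx: "j x \<in> Z" if "x \<in> ?M" for x
    using jZ that by blast
  have "embedding_map M1.mtopology M2.mtopology j"
    using jZ by (intro isometry_imp_embedding_map) auto
  then have "homeomorphic_map X (subtopology M2.mtopology (j ` ?M)) j"
    by (simp add: eX embedding_map_def)
  then obtain k where k: "homeomorphic_maps X (subtopology M2.mtopology (j ` ?M)) j k"
    unfolding homeomorphic_map_maps by blast
  have k_cont: "continuous_map (subtopology M2.mtopology (j ` ?M)) X k"
    and kj: "\<And>x. x \<in> ?M \<Longrightarrow> k (j x) = x"
    using k by (auto simp: homeomorphic_maps_def)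
  have compact_k: "compactin X (k ` C)" if "closedin M2.mtopology C" "C \<subseteq> j ` ?M" for C
  proof -
    have "compactin M2.mtopology C"
      using compact that(1) by (rule closedin_compact_space)
    then have "compactin (subtopology M2.mtopology (j ` ?M)) C"
      using that(2) by (simp add: compactin_subtopology)
    then show ?thesis
      using k_cont by (rule image_compactin)
  qed
  have k_im: "k ` j ` ?M = ?M"
    using kj by force
  show ?thesis
  \<comment> \<open>If the image is closed in the compact space \<open>Z\<close>, then
    \<open>X\<close> itself is compact; otherwise the closure supplies a point of the
    remainder.\<close>
  proof (cases "closedin M2.mtopology (j ` ?M)")
    case True
    then show ?thesis
      using compact_k[of "j ` ?M"] k_im unfolding sigma_compact_space_def
      by (intro exI[of _ "{?M}"]) auto
  next
    case False
    then obtain z0 where z0: "z0 \<in> M2.mtopology closure_of (j ` ?M)" "z0 \<notin> j ` ?M"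
      using jZ by (metis M2.topspace_mtopology closure_of_subset_eq subsetI)
    then have z0Z: "z0 \<in> Z"
      by (simp add: in_closure_of)
    have "M2.mbounded Z"
      using compact M2.compactin_imp_mbounded by (metis M2.topspace_mtopology compact_space_def)
    then obtain B where B: "\<And>z w. \<lbrakk>z \<in> Z; w \<in> Z\<rbrakk> \<Longrightarrow> \<delta> z w \<le> B"
      unfolding M2.mbounded_alt by blast
    \<comment> \<open>As \<open>z0\<close> is not in the image, \<open>q\<close> is positive; as it
      is in the closure, \<open>q\<close> has infimum 0.\<close>
    define q where "q = (\<lambda>x. \<delta> (j x) z0)"
    define f where "f = (\<lambda>z x. min (\<delta> (j x) z) (q x))"
    have q_pos: "q x > 0" if "x \<in> ?M" for x
      using z0(2) that jx z0Z unfolding q_def by (metis M2.mdist_pos_less image_eqI)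
    have tri: "\<delta> (j x) z \<le> \<delta> (j y) z + \<delta> (j x) (j y)" if "x \<in> ?M" "y \<in> ?M" "z \<in> Z" for x y z
      using M2.triangle[of "j x" "j y" z] that jx by simp
    \<comment> \<open>The metric pulled back from \<open>Z\<close> replaces \<open>d\<close>: for it
      the distance of \<open>j x\<close> to any fixed point of \<open>Z\<close> is 1-Lipschitz in
      \<open>x\<close>.\<close>
    have fsigma: "fsigma_in M2.mtopology {z \<in> Z. \<exists>x\<in>?M. f z x = 0}"
    proof (rule fsigma_zeros[OF gdelta e eX q_pos _ _ _ Z, where B = B])
      show "q x \<le> q y + \<delta> (j x) (j y)" if "x \<in> ?M" "y \<in> ?M" for x y
        using tri[OF that z0Z] by (simp add: q_def)
      then show "f z x \<le> f z y + \<delta> (j x) (j y)" if "z \<in> Z" "x \<in> ?M" "y \<in> ?M" for x y z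
        using tri[OF that(2,3,1)] that by (fastforce simp: f_def min_def)
      show "\<exists>x\<in>?M. q x < r" if r: "r > 0" for r
      proof -
        obtain x where "x \<in> ?M" "j x \<in> M2.mball z0 r"
          using z0(1) r unfolding M2.metric_closure_of by blast
        then show ?thesis
          by (auto simp: q_def M2.commute)
      qed
      show "q x \<le> B" if "x \<in> ?M" for x
        using B jx[OF that] z0Z by (simp add: q_def)
      show "f z x \<le> f w x + \<delta> z w" if "z \<in> Z" "w \<in> Z" "x \<in> ?M" for z w x
        using M2.triangle[OF jx[OF that(3)] that(2,1)] M2.commute[of w z] M2.nonneg[of z w]
        unfolding f_def by linarith
    qed (auto simp: f_def q_def)
    have f_zero: "f z x = 0 \<longleftrightarrow> z = j x" if "z \<in> Z" "x \<in> ?M" for z x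
      using q_pos[OF that(2)] M2.zero[OF jx[OF that(2)] that(1)] by (auto simp: f_def min_def)
    have "{z \<in> Z. \<exists>x\<in>?M. f z x = 0} = j ` ?M"
      using f_zero jx by blast
    then have "fsigma_in M2.mtopology (j ` ?M)"
      using fsigma by simp
    then obtain \<C> where \<C>: "countable \<C>" "\<And>C. C \<in> \<C> \<Longrightarrow> closedin M2.mtopology C" "\<Union>\<C> = j ` ?M"
      by (rule fsigma_inE) (rule that)
    \<comment> \<open>Closed subsets of \<open>Z\<close> inside the image are compact, and
      \<open>k\<close> carries them back to \<open>X\<close>.\<close>
    have "\<Union> ((`) k ` \<C>) = ?M"
      unfolding image_Union[symmetric] \<C>(3) by (rule k_im)
    then show ?thesis
      unfolding sigma_compact_space_def
    proof (intro exI[of _ "(`) k ` \<C>"] conjI ballI)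
      show "compactin X K" if K: "K \<in> (`) k ` \<C>" for K
      proof -
        obtain C where C: "C \<in> \<C>" "K = k ` C"
          using K by blast
        have "C \<subseteq> j ` ?M"
          using C(1) \<C>(3) by blast
        then show ?thesis
          using compact_k[OF \<C>(2)] C by simp
      qed
    qed (use \<C>(1) in auto)
  qed
qed

subsection \<open>Sets of reals all of whose copies are F-sigma\<close>

text \<open>Otherwise the rationals would be a G-delta set, hence a completely metrizable space
  without isolated points, and so of the cardinality of the continuum.\<close>

lemma not_fsigma_irrationals: "\<not> fsigma_in euclideanreal (- \<rat>)"
proof
  assume "fsigma_in euclideanreal (- \<rat>)"
  then have "gdelta_in euclideanreal \<rat>"
    by (simp add: gdelta_in_fsigma_in Compl_eq_Diff_UNIV)
  then have "completely_metrizable_space (top_of_set (\<rat> :: real set))"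
    by (rule completely_metrizable_space_gdelta_in[OF completely_metrizable_space_euclidean])
  moreover have "top_of_set (\<rat> :: real set) derived_set_of \<rat> = \<rat>"
  proof -
    have "\<exists>y. y \<noteq> x \<and> y \<in> \<rat> \<and> y \<in> T" if T: "open T" "x \<in> T" for x and T :: "real set"
    proof -
      obtain e where "e > 0" "ball x e \<subseteq> T"
        using openE[OF T] by blast
      moreover obtain y where "y \<in> \<rat>" "x < y" "y < x + e"
        using Rats_dense_in_real[of x "x + e"] \<open>e > 0\<close> by auto
      ultimately show ?thesis
        by (intro exI[of _ y]) (auto simp: dist_real_def subset_iff)
    qed
    then show ?thesis
      by (force simp: derived_set_of_def openin_open)
  qed
  ultimately have "(UNIV :: real set) \<lesssim> (\<rat> :: real set)"
    by (intro lepoll_perfect_set) auto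
  then show False
    using countable_lepoll countable_rat uncountable_UNIV_real by blast
qed

text \<open>The condensation points of the set form a perfect set.\<close>

lemma uncountable_closed_lepoll:
  fixes K :: "real set"
  assumes "closed K" "uncountable K"
  shows "(UNIV :: real set) \<lesssim> K"
proof -
  define S where "S = {x. \<forall>T. open T \<longrightarrow> x \<in> T \<longrightarrow> uncountable (T \<inter> K)}"
  have "S \<subseteq> K"
  proof
    fix x
    assume "x \<in> S"
    then show "x \<in> K"
      using \<open>closed K\<close> by (force simp: S_def dest!: spec[of _ "- K"])
  qed
  obtain \<B> :: "real set set" where \<B>: "countable \<B>" "topological_basis \<B>"
    using ex_countable_basis by blast
  \<comment> \<open>Each point of \<open>K - S\<close> has a basic neighbourhood meeting
    \<open>K\<close> in a countable set, and the basis is countable.\<close>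
  have "K - S \<subseteq> (\<Union>T\<in>{T \<in> \<B>. countable (T \<inter> K)}. T \<inter> K)"
  proof
    fix x
    assume x: "x \<in> K - S"
    then obtain T where T: "open T" "x \<in> T" "countable (T \<inter> K)"
      by (auto simp: S_def)
    obtain T' where T': "T' \<in> \<B>" "x \<in> T'" "T' \<subseteq> T"
      using topological_basisE[OF \<B>(2) T(1,2)] by blast
    have "countable (T' \<inter> K)"
      using T'(3) by (intro countable_subset[OF _ T(3)]) blast
    then show "x \<in> (\<Union>T\<in>{T \<in> \<B>. countable (T \<inter> K)}. T \<inter> K)"
      using x T' by blast
  qed
  moreover have "countable (\<Union>T\<in>{T \<in> \<B>. countable (T \<inter> K)}. T \<inter> K)"
    using \<B>(1) by (intro countable_UN countable_Collect) auto
  ultimately have KS: "countable (K - S)"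
    by (rule countable_subset)
  have inter: "uncountable (T \<inter> S)" if "open T" "x \<in> T" "x \<in> S" for T x
  proof
    assume "countable (T \<inter> S)"
    then have "countable (T \<inter> S \<union> (K - S))"
      using KS by blast
    moreover have "T \<inter> K \<subseteq> T \<inter> S \<union> (K - S)"
      by blast
    ultimately have "countable (T \<inter> K)"
      by (rule countable_subset[rotated])
    then show False
      using that by (auto simp: S_def)
  qed
  have "euclideanreal derived_set_of S = S"
  proof
    show "euclideanreal derived_set_of S \<subseteq> S"
    proof
      fix x
      assume x: "x \<in> euclideanreal derived_set_of S"
      have "uncountable (T \<inter> K)" if "open T" "x \<in> T" for T
        using x that by (auto simp: derived_set_of_def S_def)
      then show "x \<in> S"
        by (simp add: S_def)
    qed
    show "S \<subseteq> euclideanreal derived_set_of S"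
    proof
      fix x
      assume x: "x \<in> S"
      have "\<exists>y. y \<noteq> x \<and> y \<in> S \<and> y \<in> T" if T: "open T" "x \<in> T" for T
      proof -
        have "\<not> T \<inter> S \<subseteq> {x}"
          using inter[OF T x] countable_subset[of "T \<inter> S" "{x}"] by auto
        then show ?thesis
          by blast
      qed
      then show "x \<in> euclideanreal derived_set_of S"
        by (simp add: derived_set_of_def)
    qed
  qed
  moreover have "S \<noteq> {}"
    using KS assms(2) by auto
  ultimately have "(UNIV :: real set) \<lesssim> S"
    by (intro lepoll_perfect_set[where X = euclideanreal])
       (auto simp: completely_metrizable_space_euclidean)
  also have "S \<lesssim> K"
    using \<open>S \<subseteq> K\<close> by (rule subset_imp_lepoll)
  finally show ?thesis .
qed

lemma lepoll_total: "A \<lesssim> B \<or> B \<lesssim> A"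
proof (cases "A = {} \<or> B = {}")
  case False
  then show ?thesis
    using ordLeq_total[OF card_of_Well_order card_of_Well_order, of A B]
    unfolding card_of_ordLeq[symmetric] lepoll_def by blast
qed auto

text \<open>An uncountable \<open>D\<close> has at least the cardinality of the continuum: if it
  embeds in the reals, its F-sigma image contains an uncountable closed set. Then some subset of
  \<open>D\<close> has the irrationals as a copy.\<close>

lemma all_copies_fsigma_imp_countable:
  assumes "\<And>E \<iota>. \<lbrakk>E \<subseteq> D; inj_on \<iota> E\<rbrakk> \<Longrightarrow> fsigma_in euclideanreal (\<iota> ` E :: real set)"
  shows "countable D"
proof (rule ccontr)
  assume D: "uncountable D"
  have "(UNIV :: real set) \<lesssim> D"
    using lepoll_total[of "UNIV :: real set" D]
  proof
    assume "D \<lesssim> (UNIV :: real set)"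
    then obtain \<iota> :: "_ \<Rightarrow> real" where \<iota>: "inj_on \<iota> D"
      unfolding lepoll_def by blast
    obtain \<C> where \<C>: "countable \<C>" "\<And>C. C \<in> \<C> \<Longrightarrow> closed C" "\<Union>\<C> = \<iota> ` D"
      using assms[OF subset_refl \<iota>] by (metis fsigma_inE closed_closedin)
    have "uncountable (\<iota> ` D)"
      using \<iota> D by (metis countable_image_inj_on)
    then obtain C where C: "C \<in> \<C>" "uncountable C"
      using \<C>(1,3) countable_UN[of \<C> "\<lambda>C. C"] by auto
    have "(UNIV :: real set) \<lesssim> C"
      using uncountable_closed_lepoll C \<C>(2) by blast
    also have "C \<lesssim> \<iota> ` D"
      using C(1) \<C>(3) by (intro subset_imp_lepoll) blast
    also have "\<iota> ` D \<lesssim> D"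
      by (rule image_lepoll)
    finally show ?thesis .
  qed
  then obtain \<kappa> :: "real \<Rightarrow> _" where \<kappa>: "inj \<kappa>" "range \<kappa> \<subseteq> D"
    unfolding lepoll_def by blast
  have "inj_on (inv \<kappa>) (\<kappa> ` (- \<rat>))" "inv \<kappa> ` \<kappa> ` (- \<rat>) = - \<rat>"
    using \<kappa>(1) by (auto simp: inj_on_def image_image)
  then show False
    using assms[of "\<kappa> ` (- \<rat>)" "inv \<kappa>"] \<kappa>(2) not_fsigma_irrationals by auto
qed

subsection \<open>Nonseparable spaces\<close>

text \<open>Some \<open>e\<close> admits no countable \<open>e\<close>-net, since otherwise the
  union of countable 1/(n+1)-nets would be dense. A maximal \<open>e\<close>-separated set, from
  Zorn's lemma, is an \<open>e\<close>-net and hence uncountable.\<close>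

lemma uncountable_separated_set:
  assumes "Metric_space M d"
    and nonsep: "\<And>A. \<lbrakk>countable A; A \<subseteq> M\<rbrakk> \<Longrightarrow> \<exists>x\<in>M. \<exists>r>0. \<forall>a\<in>A. r \<le> d x a"
  obtains D e where "e > 0" "D \<subseteq> M" "uncountable D"
    "\<And>x y. \<lbrakk>x \<in> D; y \<in> D; x \<noteq> y\<rbrakk> \<Longrightarrow> e \<le> d x y"
proof -
  interpret Metric_space M d by fact
  have "\<exists>e>0. \<forall>A. countable A \<longrightarrow> A \<subseteq> M \<longrightarrow> (\<exists>x\<in>M. \<forall>a\<in>A. e \<le> d x a)"
  proof (rule ccontr)
    assume neg: "\<not> ?thesis"
    have "\<exists>A. countable A \<and> A \<subseteq> M \<and> (\<forall>x\<in>M. \<exists>a\<in>A. d x a < inverse (real (Suc n)))" for n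
    proof -
      have "inverse (real (Suc n)) > 0"
        by simp
      then show ?thesis
        using neg by (meson not_le)
    qed
    then obtain A where A: "\<And>n. countable (A n)" "\<And>n. A n \<subseteq> M"
      "\<And>n x. x \<in> M \<Longrightarrow> \<exists>a\<in>A n. d x a < inverse (real (Suc n))"
      by metis
    obtain x r where x: "x \<in> M" "r > 0" "\<And>a. a \<in> (\<Union>n. A n) \<Longrightarrow> r \<le> d x a"
      using nonsep[of "\<Union>n. A n"] A(1,2) by (metis UN_least countable_UN countableI_type)
    obtain n where "inverse (real (Suc n)) < r"
      using \<open>r > 0\<close> reals_Archimedean by blast
    then show False
      using A(3)[OF x(1), of n] x(3) by fastforce
  qed
  then obtain e where "e > 0"
    and e: "\<And>A. \<lbrakk>countable A; A \<subseteq> M\<rbrakk> \<Longrightarrow> \<exists>x\<in>M. \<forall>a\<in>A. e \<le> d x a"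
    by blast
  define \<D> where "\<D> = {D. D \<subseteq> M \<and> (\<forall>x\<in>D. \<forall>y\<in>D. x \<noteq> y \<longrightarrow> e \<le> d x y)}"
  have "\<Union> C \<in> \<D>" if "subset.chain \<D> C" for C
  proof -
    have sub: "C \<subseteq> \<D>" and chain: "\<And>S T. \<lbrakk>S \<in> C; T \<in> C\<rbrakk> \<Longrightarrow> S \<subseteq> T \<or> T \<subseteq> S"
      using that by (auto simp: subset_chain_def)
    have "e \<le> d x y" if xy: "x \<in> \<Union> C" "y \<in> \<Union> C" "x \<noteq> y" for x y
    proof -
      obtain S T where ST: "S \<in> C" "x \<in> S" "T \<in> C" "y \<in> T"
        using xy(1,2) by blast
      then obtain R where "R \<in> C" "x \<in> R" "y \<in> R"
        using chain[of S T] by blast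
      then show ?thesis
        using sub xy(3) by (auto simp: \<D>_def)
    qed
    then show ?thesis
      using sub by (auto simp: \<D>_def)
  qed
  then obtain D where D: "D \<in> \<D>" and max: "\<And>D'. \<lbrakk>D' \<in> \<D>; D \<subseteq> D'\<rbrakk> \<Longrightarrow> D' = D"
    using subset_Zorn'[of \<D>] by blast
  have "uncountable D"
  proof
    assume "countable D"
    then obtain x where x: "x \<in> M" "\<And>a. a \<in> D \<Longrightarrow> e \<le> d x a"
      using e[of D] D by (auto simp: \<D>_def)
    then have "insert x D \<in> \<D>"
      using D by (auto simp: \<D>_def commute)
    then have "x \<in> D"
      using max by blast
    then show False
      using x \<open>e > 0\<close> by force
  qed
  then show thesis
    using that[of e D] \<open>e > 0\<close> D by (auto simp: \<D>_def)
qed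

text \<open>McShane's formula: for \<open>h\<close> nonnegative on a nonempty subset
  \<open>A\<close> of a metric space, the largest 1-Lipschitz function lying below \<open>h\<close>
  on \<open>A\<close>.\<close>

definition lip_hull :: "'a set \<Rightarrow> ('a \<Rightarrow> 'a \<Rightarrow> real) \<Rightarrow> ('a \<Rightarrow> real) \<Rightarrow> 'a \<Rightarrow> real" where
  "lip_hull A d h x = (INF a\<in>A. d x a + h a)"

context
  fixes M d and A :: "'a set" and h :: "'a \<Rightarrow> real"
  assumes M: "Metric_space M d" and A: "A \<subseteq> M" "A \<noteq> {}"
    and h: "\<forall>a\<in>A. 0 \<le> h a"
begin

lemma lip_hull_lower:
  assumes "a \<in> A"
  shows "lip_hull A d h x \<le> d x a + h a"
  unfolding lip_hull_def
proof (rule cINF_lower[OF _ assms])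
  show "bdd_below ((\<lambda>a. d x a + h a) ` A)"
    using h Metric_space.nonneg[OF M] by (intro bdd_belowI[of _ 0]) fastforce
qed

lemma lip_hull_greatest: "(\<And>a. a \<in> A \<Longrightarrow> c \<le> d x a + h a) \<Longrightarrow> c \<le> lip_hull A d h x"
  unfolding lip_hull_def using A(2) by (rule cINF_greatest)

lemma lip_hull_nonneg: "0 \<le> lip_hull A d h x"
  using h Metric_space.nonneg[OF M] by (intro lip_hull_greatest) simp

lemma lip_hull_less: "lip_hull A d h x < c \<Longrightarrow> \<exists>a\<in>A. d x a + h a < c"
  using lip_hull_greatest[of c x] by force

lemma lip_hull_lipschitz:
  assumes "x \<in> M" "y \<in> M"
  shows "lip_hull A d h x \<le> lip_hull A d h y + d x y"
proof -
  have "lip_hull A d h x - d x y \<le> d y a + h a" if "a \<in> A" for a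
    using lip_hull_lower[OF that, of x] Metric_space.triangle[OF M assms, of a] A(1) that by auto
  then show ?thesis
    using lip_hull_greatest[of "lip_hull A d h x - d x y" y] by simp
qed

text \<open>Values below \<open>e / 2\<close> can come from only one point of the separated set
  \<open>A\<close>, so an infimum of 0 is attained there.\<close>

lemma lip_hull_eq_0_iff:
  assumes "e > 0" and sep: "\<And>a b. \<lbrakk>a \<in> A; b \<in> A; a \<noteq> b\<rbrakk> \<Longrightarrow> e \<le> d a b" and x: "x \<in> M"
  shows "lip_hull A d h x = 0 \<longleftrightarrow> x \<in> A \<and> h x = 0"
proof
  interpret Metric_space M d by (rule M)
  assume 0: "lip_hull A d h x = 0"
  have "\<exists>a\<in>A. d x a + h a < e / 2"
    using 0 \<open>e > 0\<close> by (intro lip_hull_less) simp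
  then obtain a where a: "a \<in> A" "d x a + h a < e / 2"
    by blast
  have aM: "a \<in> M"
    using a(1) A(1) by blast
  have "d x a + h a \<le> 0"
  proof (rule ccontr)
    assume pos: "\<not> d x a + h a \<le> 0"
    then have "\<exists>b\<in>A. d x b + h b < d x a + h a"
      using 0 by (intro lip_hull_less) simp
    then obtain b where b: "b \<in> A" "d x b + h b < d x a + h a"
      by blast
    then have "e \<le> d a b"
      using sep[OF a(1) b(1)] by auto
    moreover have "d a b \<le> d x a + d x b"
      using triangle[OF aM x, of b] b(1) A(1) commute[of a x] by auto
    ultimately show False
      using a b(2) bspec[OF h a(1)] bspec[OF h b(1)] by linarith
  qed
  then have "d x a = 0" "h a = 0"
    using bspec[OF h a(1)] nonneg[of x a] by linarith+
  then show "x \<in> A \<and> h x = 0"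
    using zero[OF x aM] a(1) by auto
next
  interpret Metric_space M d by (rule M)
  assume "x \<in> A \<and> h x = 0"
  then show "lip_hull A d h x = 0"
    using lip_hull_lower[of x x] lip_hull_nonneg[of x] x by simp
qed

end

text \<open>An uncountable separated set would contain, beside a sequence on which \<open>q\<close> tends to \<open>0\<close>,
  an uncountable set all of whose copies in the real line are F-sigma.\<close>

lemma gdelta_imp_separable:
  assumes gdelta: "gdelta_in (mtopology_of (bfun (topspace X))) (fun_of_metric (topspace X) ` BMet X)"
    and d: "Metric_space (topspace X) d" "Metric_space.mtopology (topspace X) d = X"
  shows "\<exists>A. countable A \<and> A \<subseteq> topspace X \<and> (\<forall>x\<in>topspace X. \<forall>r>0. \<exists>a\<in>A. d x a < r)"
proof (rule ccontr)
  let ?M = "topspace X"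
  interpret Metric_space ?M d by fact
  assume "\<not> ?thesis"
  then have "\<exists>x\<in>?M. \<exists>r>0. \<forall>a\<in>A. r \<le> d x a" if "countable A" "A \<subseteq> ?M" for A
    using that by (meson not_le)
  then obtain D e where "e > 0" "D \<subseteq> ?M" "uncountable D"
    and D: "\<And>x y. \<lbrakk>x \<in> D; y \<in> D; x \<noteq> y\<rbrakk> \<Longrightarrow> e \<le> d x y"
    using uncountable_separated_set[OF d(1)] by metis
  obtain c :: "nat \<Rightarrow> 'a" where c: "inj c" "range c \<subseteq> D"
    using infinite_countable_subset[OF uncountable_infinite[OF \<open>uncountable D\<close>]] by auto
  \<comment> \<open>Thus \<open>h (c n)\<close> is 1/(n+1), which gives \<open>q\<close> infimum 0
    while \<open>h\<close> has no zero; the cap 1 in \<open>q\<close> provides the bound that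
    \<open>fsigma_zeros\<close> asks for.\<close>
  define h where "h = (\<lambda>x. inverse (real (Suc (inv c x))))"
  define q where "q = (\<lambda>x. min 1 (lip_hull (range c) d h x))"
  have cM: "range c \<subseteq> ?M" "range c \<noteq> {}"
    using c(2) \<open>D \<subseteq> ?M\<close> by auto
  have h_pos: "h x > 0" for x
    by (simp add: h_def)
  have h_nonneg: "\<forall>a\<in>range c. 0 \<le> h a"
    using h_pos less_imp_le by blast
  note hull_c = d(1) cM h_nonneg
  have q_pos: "q x > 0" if "x \<in> ?M" for x
    using lip_hull_eq_0_iff[OF hull_c \<open>e > 0\<close> D that] lip_hull_nonneg[OF hull_c, of x] h_pos[of x] D c(2)
    by (auto simp: q_def less_le subset_iff)
  have q_lip: "q x \<le> q y + d x y" if "x \<in> ?M" "y \<in> ?M" for x y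
    using lip_hull_lipschitz[OF hull_c that] nonneg[of x y] unfolding q_def by linarith
  have q_inf: "\<exists>x\<in>?M. q x < r" if r: "r > 0" for r
  proof -
    obtain n where n: "inverse (real (Suc n)) < r"
      using reals_Archimedean[OF r] by blast
    have cn: "c n \<in> ?M"
      using cM(1) by blast
    have "q (c n) \<le> d (c n) (c n) + h (c n)"
      using lip_hull_lower[OF hull_c rangeI, of "c n" n] unfolding q_def by linarith
    also have "\<dots> = inverse (real (Suc n))"
      using c(1) zero[OF cn cn] by (simp add: h_def)
    finally show ?thesis
      using n cn by (intro bexI[of _ "c n"]) auto
  qed
  have "countable (D - range c)"
  proof (rule all_copies_fsigma_imp_countable)
    fix E and \<iota> :: "'a \<Rightarrow> real"
    assume E: "E \<subseteq> D - range c" and \<iota>: "inj_on \<iota> E"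
    show "fsigma_in euclideanreal (\<iota> ` E)"
    proof (cases "E = {}")
      case False
      \<comment> \<open>The hull of the distances from \<open>z\<close> to the values of
        \<open>\<iota>\<close> vanishes only at a point \<open>x\<close> of \<open>E\<close> with
        \<open>\<iota> x = z\<close>, so the parameters with a zero form the copy of
        \<open>E\<close>.\<close>
      define f where "f = (\<lambda>z x. min (q x) (lip_hull E d (\<lambda>a. \<bar>\<iota> a - z\<bar>) x))"
      have EM: "E \<subseteq> ?M"
        using E \<open>D \<subseteq> ?M\<close> by blast
      have abs_nonneg: "\<forall>a\<in>E. 0 \<le> \<bar>\<iota> a - z\<bar>" for z
        by simp
      note hull_E = d(1) EM False
      have "fsigma_in Met_TC.mtopology {z \<in> UNIV. \<exists>x\<in>?M. f z x = 0}"
      proof (rule fsigma_zeros[OF gdelta d q_pos q_lip q_inf _ Met_TC.Metric_space_axioms, where B = 1])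
        show "q x \<le> 1" for x
          by (simp add: q_def)
        show "0 \<le> f z x" if "x \<in> ?M" for z x
          using lip_hull_nonneg[OF hull_E abs_nonneg[of z]] q_pos[OF that] by (simp add: f_def)
        show "f z x \<le> q x" for z x
          by (simp add: f_def)
        show "f z x \<le> f z y + d x y" if "x \<in> ?M" "y \<in> ?M" for z x y
          using lip_hull_lipschitz[OF hull_E abs_nonneg[of z] that] q_lip[OF that]
          unfolding f_def by linarith
        \<comment> \<open>Moving the parameter changes all the terms of the infimum by at most
          \<open>dist z w\<close>.\<close>
        show "f z x \<le> f w x + dist z w" for z w x
        proof -
          have "lip_hull E d (\<lambda>a. \<bar>\<iota> a - z\<bar>) x - dist z w \<le> d x a + \<bar>\<iota> a - w\<bar>" if "a \<in> E" for a
            using lip_hull_lower[OF hull_E abs_nonneg[of z] that, of x] unfolding dist_real_def by linarith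
          then have "lip_hull E d (\<lambda>a. \<bar>\<iota> a - z\<bar>) x - dist z w \<le> lip_hull E d (\<lambda>a. \<bar>\<iota> a - w\<bar>) x"
            by (rule lip_hull_greatest[OF hull_E abs_nonneg[of w]])
          then show ?thesis
            using zero_le_dist[of z w] unfolding f_def by linarith
        qed
      qed
      moreover have "(\<exists>x\<in>?M. f z x = 0) \<longleftrightarrow> z \<in> \<iota> ` E" for z
      proof -
        have "f z x = 0 \<longleftrightarrow> x \<in> E \<and> z = \<iota> x" if "x \<in> ?M" for x
        proof -
          have "f z x = 0 \<longleftrightarrow> lip_hull E d (\<lambda>a. \<bar>\<iota> a - z\<bar>) x = 0"
            using q_pos[OF that] lip_hull_nonneg[OF hull_E abs_nonneg[of z], of x]
            unfolding f_def by linarith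
          also have "\<dots> \<longleftrightarrow> x \<in> E \<and> \<bar>\<iota> x - z\<bar> = 0"
            using E by (intro lip_hull_eq_0_iff[OF hull_E abs_nonneg \<open>e > 0\<close> D that]) auto
          finally show ?thesis
            by auto
        qed
        then show ?thesis
          using EM by blast
      qed
      ultimately show ?thesis
        by simp
    qed simp
  qed
  then have "countable ((D - range c) \<union> range c)"
    by blast
  moreover have "D \<subseteq> (D - range c) \<union> range c"
    by blast
  ultimately show False
    using \<open>uncountable D\<close> countable_subset by blast
qed

theorem corollary3p7:
  fixes X :: "'a topology"
  assumes "metrizable_space X"
  shows "completely_metrizable_space (BMet_topology X) \<longleftrightarrow> sigma_compact_space X"
  unfolding completely_metrizable_BMet_iff_gdelta
proof
  assume gdelta: "gdelta_in (mtopology_of (bfun (topspace X))) (fun_of_metric (topspace X) ` BMet X)"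
  obtain d where d: "Metric_space (topspace X) d" "Metric_space.mtopology (topspace X) d = X"
    using assms Metric_space.topspace_mtopology unfolding metrizable_space_def by metis
  obtain A where "countable A" "A \<subseteq> topspace X" "\<forall>x\<in>topspace X. \<forall>r>0. \<exists>a\<in>A. d x a < r"
    using gdelta_imp_separable[OF gdelta d] by blast
  then show "sigma_compact_space X"
    by (intro separable_gdelta_imp_sigma_compact[OF gdelta d]) auto
next
  assume "sigma_compact_space X"
  then show "gdelta_in (mtopology_of (bfun (topspace X))) (fun_of_metric (topspace X) ` BMet X)"
    by (rule gdelta_BMet[OF assms])
qed

end
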